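(* Let $A, B \subseteq \Sigma^*$ be infinite sets, where $\Sigma=\{0,1\}$. (1) If $B$ is recursive, then $A$ is $\mathrm{F}_{\mathrm{REC}}$-compressible to $B$ if and only if $A$ is $\mathrm{F}_{\mathrm{REC}}$-compressible to $\Sigma^*$. (2) If $B$ is recursively enumerable, then $A$ is $\mathrm{F}_{\mathrm{PR}}$-compressible to $B$ if and only if $A$ is $\mathrm{F}_{\mathrm{PR}}$-compressible to $\Sigma^*$.
   Context: $\mathrm{F}_{\mathrm{REC}}$ is the class of total recursive functions from $\Sigma^*$ to $\Sigma^*$ and $\mathrm{F}_{\mathrm{PR}}$ the class of partial recursive functions from $\Sigma^*$ to $\Sigma^*$. Given sets $A, B\subseteq\Sigma^*$, a (possibly partial) function $f$ is a compression function for $A$ to $B$ if (a) $\mathrm{domain}(f)\supseteq A$, (b) $f(A)=B$, and (c) for all $a\neq b$ in $A$, $f(a)\neq f(b)$. (No condition is imposed on $f$ outside $A$; in particular $f(\Sigma^* )=B$ is not required.) For a class $\mathcal F$ of (possibly partial) functions, $A$ is $\mathcal F$-compressible to $B$ if some $f\in\mathcal F$ is a compression function for $A$ to $B$. *)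

theory Defs
  imports Main
begin

text \<open>Kleene's partial recursive functions on the natural numbers.\<close>

datatype recf =
    Zero
  | Succ
  | Proj nat
  | Comp recf "recf list"
  | PrimRec recf recf
  | Mu recf

fun has_arity :: "nat \<Rightarrow> recf \<Rightarrow> bool" where
  "has_arity k Zero \<longleftrightarrow> True"
| "has_arity k Succ \<longleftrightarrow> k = 1"
| "has_arity k (Proj i) \<longleftrightarrow> i < k"
| "has_arity k (Comp f gs) \<longleftrightarrow> has_arity (length gs) f \<and> (\<forall>g\<in>set gs. has_arity k g)"
| "has_arity k (PrimRec f g) \<longleftrightarrow> k > 0 \<and> has_arity (k - 1) f \<and> has_arity (k + 1) g"
| "has_arity k (Mu f) \<longleftrightarrow> has_arity (k + 1) f"

text \<open>
  The value \<open>None\<close> means that the computation diverges. Composition is strict in all its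
  arguments. Recursion and minimisation act on the first argument. Minimisation yields the least
  zero, and requires the values at all smaller arguments to be defined.
  The result is meaningful only if \<open>r\<close> has arity \<open>length xs\<close>.
\<close>

fun eval :: "recf \<Rightarrow> nat list \<Rightarrow> nat option" where
  "eval Zero xs = Some 0"
| "eval Succ xs = Some (Suc (xs ! 0))"
| "eval (Proj i) xs = Some (xs ! i)"
| "eval (Comp f gs) xs = Option.bind (those (map (\<lambda>g. eval g xs) gs)) (eval f)"
| "eval (PrimRec f g) xs =
     rec_nat (eval f (tl xs))
       (\<lambda>n v. Option.bind v (\<lambda>y. eval g (n # y # tl xs)))
       (hd xs)"
| "eval (Mu f) xs =
     (if \<exists>n. eval f (n # xs) = Some 0 \<and> (\<forall>m<n. eval f (m # xs) \<noteq> None)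
      then Some (LEAST n. eval f (n # xs) = Some 0)
      else None)"

text \<open>
  Strings over \<open>{0,1}\<close> are lists of Booleans. They are identified with natural numbers by their
  position in the length-lexicographic order (empty, 0, 1, 00, 01, ...), that is, a string \<open>w\<close>
  is coded by the number with binary representation \<open>1w\<close>, minus one.
\<close>

definition str_code :: "bool list \<Rightarrow> nat" where
  "str_code w = foldl (\<lambda>n b. 2 * n + (if b then 2 else 1)) 0 w"

lemma str_code_Nil [simp]: "str_code [] = 0"
  by (simp add: str_code_def)

lemma str_code_snoc [simp]: "str_code (w @ [b]) = 2 * str_code w + (if b then 2 else 1)"
  by (simp add: str_code_def)

lemma bij_str_code: "bij str_code"
proof (rule bijI)
  show "inj str_code"
  proof (rule injI)
    fix v w :: "bool list"
    show "str_code v = str_code w \<Longrightarrow> v = w"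
    proof (induction v arbitrary: w rule: rev_induct)
      case Nil
      then show ?case by (cases w rule: rev_cases) (auto split: if_splits)
    next
      case (snoc b v)
      from snoc.prems obtain c w' where w: "w = w' @ [c]"
        by (cases w rule: rev_cases) (auto split: if_splits)
      from snoc.prems have "2 * str_code v + (if b then 2 else 1)
          = 2 * str_code w' + (if c then 2 else 1)"
        by (simp add: w)
      then have "b = c \<and> str_code v = str_code w'"
        by (cases b; cases c; simp; presburger)
      then show ?case using snoc.IH w by blast
    qed
  qed
  show "surj str_code"
  proof -
    have "\<exists>w. str_code w = n" for n
    proof (induction n rule: less_induct)
      case (less n)
      show ?case
      proof (cases "n = 0")
        case True
        then show ?thesis using str_code_Nil by blast
      next
        case False
        then have "(n - 1) div 2 < n" by linarith
        then obtain w where w: "str_code w = (n - 1) div 2"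
          using less.IH by blast
        have "str_code (w @ [even n]) = n"
          using False w by simp presburger
        then show ?thesis by blast
      qed
    qed
    then show ?thesis by (metis surjI)
  qed
qed

definition F_PR :: "(bool list \<Rightarrow> bool list option) set" where
  "F_PR = {f. \<exists>r. has_arity 1 r \<and> (\<forall>w. eval r [str_code w] = map_option str_code (f w))}"

definition F_REC :: "(bool list \<Rightarrow> bool list option) set" where
  "F_REC = {f \<in> F_PR. dom f = UNIV}"

definition recursive :: "bool list set \<Rightarrow> bool" where
  "recursive B \<longleftrightarrow> (\<lambda>w. Some (if w \<in> B then [True] else [False])) \<in> F_REC"

definition recursively_enumerable :: "bool list set \<Rightarrow> bool" where
  "recursively_enumerable B \<longleftrightarrow> B = {} \<or> (\<exists>f\<in>F_REC. ran f = B)"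

definition compression_function ::
  "(bool list \<Rightarrow> bool list option) \<Rightarrow> bool list set \<Rightarrow> bool list set \<Rightarrow> bool" where
  "compression_function f A B \<longleftrightarrow> A \<subseteq> dom f \<and> f ` A = Some ` B \<and> inj_on f A"

definition compressible ::
  "(bool list \<Rightarrow> bool list option) set \<Rightarrow> bool list set \<Rightarrow> bool list set \<Rightarrow> bool" where
  "compressible F A B \<longleftrightarrow> (\<exists>f\<in>F. compression_function f A B)"

end

theory Submission
  imports Defs
begin

text \<open>
  If \<open>e\<close> is a bijection from \<open>\<Sigma>\<^sup>*\<close> onto \<open>B\<close> in the class \<open>F\<close> and \<open>F\<close> contains a function that
  inverts \<open>e\<close> on \<open>B\<close>, then composition with \<open>e\<close> and with this inverse turns compression functions
  to \<open>\<Sigma>\<^sup>*\<close> into compression functions to \<open>B\<close> and back. For recursive \<open>B\<close>, take the increasing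
  enumeration of \<open>B\<close>; its inverse extends to the total function that counts the smaller elements
  of \<open>B\<close>. If \<open>B\<close> is the range of a recursive \<open>h\<close>, let \<open>D\<close> be the recursive set of all \<open>n\<close> at which
  \<open>h\<close> takes its value for the first time. Then \<open>h\<close> maps \<open>D\<close> bijectively onto \<open>B\<close>, and searching
  for the first \<open>n\<close> with \<open>h n = y\<close> inverts this bijection.
\<close>

section \<open>Closure properties of recursive functions on numbers\<close>

text \<open>Formulated for semantic functions so that the closure rules compose without handling
  \<open>recf\<close> terms. Other lengths are left out because \<open>eval\<close> is meaningful
  only at the right arity.\<close>

definition partial_rec :: "nat \<Rightarrow> (nat list \<Rightarrow> nat option) \<Rightarrow> bool" where
  "partial_rec k f \<longleftrightarrow> (\<exists>r. has_arity k r \<and> (\<forall>xs. length xs = k \<longrightarrow> eval r xs = f xs))"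

abbreviation total_rec :: "nat \<Rightarrow> (nat list \<Rightarrow> nat) \<Rightarrow> bool" where
  "total_rec k f \<equiv> partial_rec k (\<lambda>xs. Some (f xs))"

lemma partial_rec_cong:
  assumes "partial_rec k f" and "\<And>xs. length xs = k \<Longrightarrow> f xs = g xs"
  shows "partial_rec k g"
  using assms unfolding partial_rec_def by metis

lemma partial_rec_comp:
  assumes "partial_rec (length fs) g" and "\<And>f. f \<in> set fs \<Longrightarrow> partial_rec k f"
  shows "partial_rec k (\<lambda>xs. Option.bind (those (map (\<lambda>f. f xs) fs)) g)"
proof -
  obtain r where r: "has_arity (length fs) r" "\<And>xs. length xs = length fs \<Longrightarrow> eval r xs = g xs"
    using assms(1) by (auto simp: partial_rec_def)
  have "\<forall>f\<in>set fs. \<exists>s. has_arity k s \<and> (\<forall>xs. length xs = k \<longrightarrow> eval s xs = f xs)"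
    using assms(2) by (auto simp: partial_rec_def)
  then obtain S where S: "\<And>f. f \<in> set fs \<Longrightarrow> has_arity k (S f)"
      "\<And>f xs. f \<in> set fs \<Longrightarrow> length xs = k \<Longrightarrow> eval (S f) xs = f xs"
    by metis
  \<comment> \<open>\<open>r\<close> is specified only on lists as long as \<open>fs\<close>;
    \<open>those\<close> preserves length, so its result qualifies.\<close>
  have len: "those zs = Some ys \<Longrightarrow> length ys = length zs" for zs :: "nat option list" and ys
    by (induction zs arbitrary: ys) (auto split: option.splits)
  have "eval (Comp r (map S fs)) xs = Option.bind (those (map (\<lambda>f. f xs) fs)) g"
    if "length xs = k" for xs
  proof -
    have "map (\<lambda>s. eval s xs) (map S fs) = map (\<lambda>f. f xs) fs"
      using S(2) that by simp
    then have "eval (Comp r (map S fs)) xs = Option.bind (those (map (\<lambda>f. f xs) fs)) (eval r)"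
      by (simp only: eval.simps)
    then show ?thesis
      using r(2) len[of "map (\<lambda>f. f xs) fs"]
      by (cases "those (map (\<lambda>f. f xs) fs)") auto
  qed
  moreover have "has_arity k (Comp r (map S fs))"
    using r(1) S(1) by simp
  ultimately show ?thesis
    unfolding partial_rec_def by blast
qed

lemma partial_rec_comp1:
  assumes "partial_rec 1 (\<lambda>xs. g (xs ! 0))" and "partial_rec k f"
  shows "partial_rec k (\<lambda>xs. Option.bind (f xs) g)"
proof -
  have "partial_rec k (\<lambda>xs. Option.bind (those (map (\<lambda>f. f xs) [f])) (\<lambda>xs. g (xs ! 0)))"
    by (rule partial_rec_comp) (use assms in auto)
  then show ?thesis
    by (rule partial_rec_cong) (simp split: option.splits bind_splits)
qed

lemma total_rec_comp:
  assumes "total_rec (length fs) g" and "\<And>f. f \<in> set fs \<Longrightarrow> total_rec k f"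
  shows "total_rec k (\<lambda>xs. g (map (\<lambda>f. f xs) fs))"
proof -
  have "partial_rec k (\<lambda>xs. Option.bind (those (map (\<lambda>f. f xs) (map (\<lambda>f xs. Some (f xs)) fs)))
      (\<lambda>xs. Some (g xs)))"
    by (rule partial_rec_comp) (use assms in auto)
  moreover have "those (map (\<lambda>f. f xs) (map (\<lambda>f xs. Some (f xs)) fs)) = Some (map (\<lambda>f. f xs) fs)"
    for xs :: "nat list"
    by (induction fs) auto
  ultimately show ?thesis
    by simp
qed

lemma total_rec_comp1:
  assumes "total_rec 1 (\<lambda>xs. g (xs ! 0))" and "total_rec k f"
  shows "total_rec k (\<lambda>xs. g (f xs))"
  using total_rec_comp[of "[f]" "\<lambda>xs. g (xs ! 0)" k] assms by auto

lemma total_rec_proj: "i < k \<Longrightarrow> total_rec k (\<lambda>xs. xs ! i)"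
  unfolding partial_rec_def by (rule exI[of _ "Proj i"]) simp

lemma total_rec_Suc:
  assumes "total_rec k f"
  shows "total_rec k (\<lambda>xs. Suc (f xs))"
proof (rule total_rec_comp1[OF _ assms])
  show "total_rec 1 (\<lambda>xs. Suc (xs ! 0))"
    unfolding partial_rec_def by (rule exI[of _ Succ]) simp
qed

lemma total_rec_const: "total_rec k (\<lambda>xs. n)"
proof (induction n)
  case 0
  show ?case unfolding partial_rec_def by (rule exI[of _ Zero]) simp
next
  case (Suc n)
  then show ?case by (rule total_rec_Suc)
qed

text \<open>\<open>PrimRec\<close> consumes its first argument as counter. Here the counter is
  itself computed from the arguments; composition with \<open>h\<close> and projections puts it in
  front of the unchanged list.\<close>

lemma total_rec_primrec:
  assumes "total_rec k f" and "total_rec (Suc (Suc k)) g" and "total_rec k h"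
  shows "total_rec k (\<lambda>xs. rec_nat (f xs) (\<lambda>n y. g (n # y # xs)) (h xs))"
proof -
  obtain r where r: "has_arity k r" "\<And>xs. length xs = k \<Longrightarrow> eval r xs = Some (f xs)"
    using assms(1) by (auto simp: partial_rec_def)
  obtain s where s: "has_arity (Suc (Suc k)) s"
      "\<And>xs. length xs = Suc (Suc k) \<Longrightarrow> eval s xs = Some (g xs)"
    using assms(2) by (auto simp: partial_rec_def)
  define R where "R xs = rec_nat (f (tl xs)) (\<lambda>n y. g (n # y # tl xs)) (hd xs)" for xs
  have "rec_nat (eval r ys) (\<lambda>n v. Option.bind v (\<lambda>y. eval s (n # y # ys))) n
      = Some (rec_nat (f ys) (\<lambda>n y. g (n # y # ys)) n)"
    if "length ys = k" for ys n
    using r(2) s(2) that by (induction n) auto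
  then have "total_rec (Suc k) R"
    unfolding partial_rec_def R_def using r(1) s(1)
    by (intro exI[of _ "PrimRec r s"]) auto
  moreover define fs where "fs = h # map (\<lambda>i xs. xs ! i) [0..<k]"
  ultimately have "total_rec k (\<lambda>xs. R (map (\<lambda>f. f xs) fs))"
    by (intro total_rec_comp) (auto intro: assms(3) total_rec_proj)
  moreover have "map (\<lambda>f. f xs) fs = h xs # xs" if "length xs = k" for xs
    using that map_nth[of xs] by (simp add: fs_def comp_def)
  ultimately show ?thesis
    by (elim partial_rec_cong) (simp add: R_def)
qed

text \<open>Totality of \<open>f\<close> discharges the demand of \<open>Mu\<close> that all values
  before the zero be defined.\<close>

lemma partial_rec_Least:
  assumes "total_rec (Suc k) f"
  shows "partial_rec k
    (\<lambda>xs. if \<exists>n. f (n # xs) = 0 then Some (LEAST n. f (n # xs) = 0) else None)"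
proof -
  obtain r where r: "has_arity (Suc k) r"
      "\<And>xs. length xs = Suc k \<Longrightarrow> eval r xs = Some (f xs)"
    using assms by (auto simp: partial_rec_def)
  have "eval (Mu r) xs = (if \<exists>n. f (n # xs) = 0 then Some (LEAST n. f (n # xs) = 0) else None)"
    if "length xs = k" for xs
  proof -
    have "eval r (n # xs) = Some (f (n # xs))" for n
      using r(2) that by simp
    then show ?thesis by simp
  qed
  moreover have "has_arity k (Mu r)"
    using r(1) by simp
  ultimately show ?thesis
    unfolding partial_rec_def by blast
qed

lemma total_rec_Least:
  assumes "total_rec (Suc k) f" and "\<And>xs. length xs = k \<Longrightarrow> \<exists>n. f (n # xs) = 0"
  shows "total_rec k (\<lambda>xs. LEAST n. f (n # xs) = 0)"
  using partial_rec_Least[OF assms(1)] by (rule partial_rec_cong) (use assms(2) in auto)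

lemma total_rec_monus:
  assumes "total_rec k f" and "total_rec k g"
  shows "total_rec k (\<lambda>xs. f xs - g xs)"
proof -
  \<comment> \<open>A recursion that returns its counter instead of using the previous value yields
    the predecessor; iterating the predecessor yields truncated subtraction.\<close>
  have pred: "total_rec m (\<lambda>xs. h xs - 1)" if "total_rec m h" for m h
  proof -
    have "total_rec m (\<lambda>xs. rec_nat 0 (\<lambda>n y. (n # y # xs) ! 0) (h xs))"
      using total_rec_const total_rec_proj that by (intro total_rec_primrec) auto
    moreover have "rec_nat 0 (\<lambda>n y. n) x = x - 1" for x :: nat
      by (cases x) auto
    ultimately show ?thesis by simp
  qed
  have "total_rec k (\<lambda>xs. rec_nat (f xs) (\<lambda>n y. (n # y # xs) ! 1 - 1) (g xs))"
    using assms by (intro total_rec_primrec[where g = "\<lambda>zs. zs ! 1 - 1"] pred total_rec_proj) auto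
  moreover have "rec_nat x (\<lambda>n y. y - 1) y = x - y" for x y :: nat
    by (induction y) auto
  ultimately show ?thesis by simp
qed

lemma total_rec_if:
  assumes "total_rec k p" and "total_rec k f" and "total_rec k g"
  shows "total_rec k (\<lambda>xs. if p xs = 0 then f xs else g xs)"
proof -
  have *: "total_rec k (\<lambda>xs. rec_nat (h xs) (\<lambda>n y. 0) (q xs))"
    if "total_rec k h" "total_rec k q" for h q
    using total_rec_primrec[OF that(1) total_rec_const that(2)] .
  have **: "rec_nat x (\<lambda>n y. 0) b = (if b = 0 then x else 0)" for x b :: nat
    by (cases b) auto
  have select: "total_rec k (\<lambda>xs. if q xs = 0 then h xs else 0)"
    if "total_rec k h" "total_rec k q" for h q
    using *[OF that] by (simp add: **)
  \<comment> \<open>At most one summand differs from 0, as \<open>1 - p xs\<close> vanishes exactly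
    if \<open>p xs\<close> does not. The outer recursion adds the two.\<close>
  have "total_rec k (\<lambda>xs. rec_nat (if p xs = 0 then f xs else 0)
      (\<lambda>n y. Suc ((n # y # xs) ! 1)) (if 1 - p xs = 0 then g xs else 0))"
    using assms
    by (intro total_rec_primrec[where g = "\<lambda>zs. Suc (zs ! 1)"] select total_rec_Suc
      total_rec_monus total_rec_const total_rec_proj) auto
  moreover have "rec_nat x (\<lambda>n. Suc) y = x + y" for x y :: nat
    by (induction y) auto
  ultimately show ?thesis
    by (elim partial_rec_cong) auto
qed

text \<open>Inequality rather than equality, because minimisation and \<open>total_rec_if\<close>
  treat 0 as success.\<close>

lemma total_rec_neq:
  assumes "total_rec k f" and "total_rec k g"
  shows "total_rec k (\<lambda>xs. of_bool (f xs \<noteq> g xs))"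
proof -
  have "total_rec k (\<lambda>xs. if f xs - g xs = 0 then if g xs - f xs = 0 then 0 else 1 else 1)"
    by (intro total_rec_if total_rec_monus total_rec_const assms)
  then show ?thesis
    by (rule partial_rec_cong) auto
qed

section \<open>Enumerating infinite recursive and recursively enumerable sets of numbers\<close>

text \<open>The number \<open>c n\<close> of zeros of \<open>p\<close> below \<open>n\<close>
  separates the zeros and, as there are infinitely many, takes every value on them. Hence
  minimisation finds the zero \<open>e k\<close> with count \<open>k\<close>.\<close>

lemma recursive_enumeration:
  fixes p :: "nat \<Rightarrow> nat"
  assumes p: "total_rec 1 (\<lambda>xs. p (xs ! 0))" and inf: "infinite {n. p n = 0}"
  shows "\<exists>e c. total_rec 1 (\<lambda>xs. e (xs ! 0)) \<and> total_rec 1 (\<lambda>xs. c (xs ! 0)) \<and>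
    range e = {n. p n = 0} \<and> (\<forall>k. c (e k) = k)"
proof -
  define c where "c n = rec_nat 0 (\<lambda>n y. if p n = 0 then Suc y else y) n" for n
  have c_simps: "c 0 = 0" "c (Suc n) = (if p n = 0 then Suc (c n) else c n)" for n
    by (simp_all add: c_def)
  have "total_rec 1 (\<lambda>xs. rec_nat 0
      (\<lambda>n y. if p ((n # y # xs) ! 0) = 0 then Suc ((n # y # xs) ! 1) else (n # y # xs) ! 1) (xs ! 0))"
    by (intro total_rec_primrec[where g = "\<lambda>zs. if p (zs ! 0) = 0 then Suc (zs ! 1) else zs ! 1"]
      total_rec_if total_rec_comp1[OF p] total_rec_Suc total_rec_const total_rec_proj) auto
  then have c: "total_rec 1 (\<lambda>xs. c (xs ! 0))"
    by (simp add: c_def cong: if_cong)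
  have mono: "c m \<le> c n" if "m \<le> n" for m n
    using that by (induction rule: dec_induct) (auto simp: c_simps)
  have less: "c m < c n" if "p m = 0" "m < n" for m n
    using mono[of "Suc m" n] that by (simp add: c_simps)
  have inj: "m = n" if "p m = 0" "p n = 0" "c m = c n" for m n
    using less[of m n] less[of n m] that by (cases m n rule: linorder_cases) auto
  \<comment> \<open>The least zero has count 0. Passing a zero with count \<open>k\<close> raises
    the count to \<open>Suc k\<close>, where it stays up to the next zero.\<close>
  have surj: "\<exists>n. p n = 0 \<and> c n = k" for k
  proof (induction k)
    case 0
    obtain n where n: "p n = 0" "\<And>m. m < n \<Longrightarrow> p m \<noteq> 0"
      using infinite_imp_nonempty[OF inf] exists_least_iff[of "\<lambda>n. p n = 0"] by auto
    have "m \<le> n \<Longrightarrow> c m = 0" for m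
      by (induction m) (auto simp: c_simps n(2))
    with n(1) show ?case by blast
  next
    case (Suc k)
    then obtain n where n: "p n = 0" "c n = k" by blast
    have "\<exists>m>n. p m = 0"
      using inf unfolding finite_nat_set_iff_bounded_le by (auto simp: not_le)
    then obtain m where m: "n < m" "p m = 0" "\<And>l. n < l \<Longrightarrow> l < m \<Longrightarrow> p l \<noteq> 0"
      using exists_least_iff[of "\<lambda>m. n < m \<and> p m = 0"] by auto
    have "l \<le> m \<Longrightarrow> c l = Suc k" if "Suc n \<le> l" for l
      using that by (induction rule: dec_induct) (auto simp: c_simps n m(3))
    from this[of m] m show ?case by auto
  qed
  \<comment> \<open>Both tests are folded into one value, with the candidate zero in position 0,
    where minimisation searches.\<close>
  define q where "q zs = (if p (zs ! 0) = 0 then of_bool (c (zs ! 0) \<noteq> zs ! 1) else (1 :: nat))"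
    for zs
  have q: "q (n # xs) = 0 \<longleftrightarrow> p n = 0 \<and> c n = xs ! 0" for n xs
    by (simp add: q_def)
  define e where "e k = (LEAST n. q [n, k] = 0)" for k
  have "total_rec (Suc 1) q"
    unfolding q_def
    by (intro total_rec_if total_rec_neq total_rec_comp1[OF p] total_rec_comp1[OF c]
      total_rec_const total_rec_proj) auto
  from total_rec_Least[OF this] have "total_rec 1 (\<lambda>xs. LEAST n. q (n # xs) = 0)"
    using surj by (simp add: q)
  then have e: "total_rec 1 (\<lambda>xs. e (xs ! 0))"
    by (simp add: e_def q)
  have e': "p (e k) = 0 \<and> c (e k) = k" for k
    unfolding e_def q using LeastI_ex[OF surj[of k]] by simp
  \<comment> \<open>The search for the count \<open>c n\<close> can only return \<open>n\<close>, by
    injectivity on zeros.\<close>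
  have "n \<in> range e" if "p n = 0" for n
    using inj[of "e (c n)" n] e'[of "c n"] that by (metis rangeI)
  then have "range e = {n. p n = 0}"
    using e' by auto
  with e c e' show ?thesis
    by blast
qed

text \<open>Membership in \<open>range h\<close> may be undecidable, but being a first occurrence is
  decidable. So the indices of first occurrences are enumerated, and \<open>h\<close> is applied
  afterwards to list the values without repetition.\<close>

lemma recursively_enumerable_enumeration:
  fixes h :: "nat \<Rightarrow> nat"
  assumes h: "total_rec 1 (\<lambda>xs. h (xs ! 0))" and inf: "infinite (range h)"
  shows "\<exists>e g. total_rec 1 (\<lambda>xs. e (xs ! 0)) \<and> partial_rec 1 (\<lambda>xs. g (xs ! 0)) \<and>
    range e = range h \<and> (\<forall>k. g (e k) = Some k)"
proof -
  define d where "d zs = (of_bool (h (zs ! 0) \<noteq> zs ! 1) :: nat)" for zs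
  have d: "total_rec (Suc 1) d"
    unfolding d_def by (intro total_rec_neq total_rec_comp1[OF h] total_rec_proj) auto
  \<comment> \<open>Outside \<open>range h\<close> this \<open>LEAST\<close> is unspecified, so
    every use is restricted to values of \<open>h\<close>.\<close>
  define first where "first y = (LEAST n. h n = y)" for y
  have first: "h (first (h n)) = h n" for n
    unfolding first_def by (rule LeastI) simp
  \<comment> \<open>The search for \<open>n\<close> with \<open>h n = h x\<close> succeeds at
    \<open>n = x\<close> at the latest, so \<open>first\<close> after \<open>h\<close> is total
    recursive.\<close>
  have "total_rec (Suc 1) (\<lambda>zs. of_bool (h (zs ! 0) \<noteq> h (zs ! 1)))"
    by (intro total_rec_neq total_rec_comp1[OF h] total_rec_proj) auto
  from total_rec_Least[OF this] have "total_rec 1 (\<lambda>xs. first (h (xs ! 0)))"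
    by (simp add: first_def) blast
  then have D: "total_rec 1 (\<lambda>xs. of_bool (first (h (xs ! 0)) \<noteq> xs ! 0))"
    by (intro total_rec_neq total_rec_proj) auto
  have img: "h ` {n. first (h n) = n} = range h"
    using first by (auto simp: image_iff) metis
  with inf have "infinite {n. first (h n) = n}"
    by (metis finite_imageI)
  then obtain e c where e: "total_rec 1 (\<lambda>xs. e (xs ! 0))" and c: "total_rec 1 (\<lambda>xs. c (xs ! 0))"
    and ran: "range e = {n. first (h n) = n}" and ce: "\<And>k. c (e k) = k"
    using recursive_enumeration[OF D] by auto
  \<comment> \<open>The search for a first occurrence diverges exactly outside
    \<open>range h\<close>; on success \<open>c\<close> turns the index found into its rank.\<close>
  define g where "g y = (if y \<in> range h then Some (c (first y)) else None)" for y
  have "partial_rec 1 (\<lambda>xs. Option.bind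
      (if \<exists>n. d (n # xs) = 0 then Some (LEAST n. d (n # xs) = 0) else None) (\<lambda>n. Some (c n)))"
    by (intro partial_rec_comp1 c partial_rec_Least d)
  then have g: "partial_rec 1 (\<lambda>xs. g (xs ! 0))"
    by (rule partial_rec_cong) (auto simp: d_def g_def first_def intro: range_eqI[OF sym])
  show ?thesis
  proof (intro exI conjI allI)
    show "total_rec 1 (\<lambda>xs. h (e (xs ! 0)))"
      by (rule total_rec_comp1[OF h e])
    show "partial_rec 1 (\<lambda>xs. g (xs ! 0))"
      by (rule g)
    show "range (\<lambda>k. h (e k)) = range h"
      using img ran by (metis image_image)
    have "first (h (e k)) = e k" for k
      using ran by auto
    then show "g (h (e k)) = Some k" for k
      by (simp add: g_def ce)
  qed
qed

section \<open>Transfer from numbers to strings\<close>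

abbreviation str_decode :: "nat \<Rightarrow> bool list" where
  "str_decode \<equiv> inv str_code"

lemma str_code_decode [simp]: "str_code (str_decode n) = n"
  using bij_str_code by (simp add: bij_is_surj surj_f_inv_f)

lemma str_decode_code [simp]: "str_decode (str_code w) = w"
  using bij_str_code by (simp add: bij_is_inj)

text \<open>As \<open>str_code\<close> is a bijection, the codes of strings exhaust the one-element
  argument lists.\<close>

lemma F_PR_iff: "f \<in> F_PR \<longleftrightarrow> partial_rec 1 (\<lambda>xs. map_option str_code (f (str_decode (xs ! 0))))"
proof
  show "partial_rec 1 (\<lambda>xs. map_option str_code (f (str_decode (xs ! 0))))" if pr: "f \<in> F_PR"
  proof -
    obtain r where r: "has_arity 1 r" "\<And>w. eval r [str_code w] = map_option str_code (f w)"
      using pr unfolding F_PR_def by blast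
    have "eval r xs = map_option str_code (f (str_decode (xs ! 0)))" if "length xs = 1" for xs
      using that r(2)[of "str_decode (xs ! 0)"] by (cases xs) auto
    with r(1) show ?thesis
      unfolding partial_rec_def by blast
  qed
  show "f \<in> F_PR" if pr: "partial_rec 1 (\<lambda>xs. map_option str_code (f (str_decode (xs ! 0))))"
  proof -
    obtain r where "has_arity 1 r"
      and r: "\<And>xs. length xs = 1 \<Longrightarrow> eval r xs = map_option str_code (f (str_decode (xs ! 0)))"
      using pr unfolding partial_rec_def by blast
    then show ?thesis
      using r[of "[str_code _]"] by (auto simp: F_PR_def)
  qed
qed

lemma F_PR_I:
  assumes "partial_rec 1 (\<lambda>xs. f (xs ! 0))"
  shows "(\<lambda>w. map_option str_decode (f (str_code w))) \<in> F_PR"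
  using assms by (simp add: F_PR_iff option.map_comp comp_def option.map_ident)

lemma F_REC_I:
  assumes "total_rec 1 (\<lambda>xs. f (xs ! 0))"
  shows "(\<lambda>w. Some (str_decode (f (str_code w)))) \<in> F_REC"
  using F_PR_I[of "\<lambda>n. Some (f n)"] assms by (auto simp: F_REC_def)

lemma F_REC_D:
  assumes "f \<in> F_REC"
  shows "\<exists>h. total_rec 1 (\<lambda>xs. h (xs ! 0)) \<and> (\<forall>w. f w = Some (str_decode (h (str_code w))))"
proof -
  have "\<forall>w. \<exists>v. f w = Some v"
    using assms by (auto simp: F_REC_def)
  then obtain F where F: "\<And>w. f w = Some (F w)" by metis
  have "f \<in> F_PR"
    using assms by (simp add: F_REC_def)
  then have "total_rec 1 (\<lambda>xs. str_code (F (str_decode (xs ! 0))))"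
    by (simp add: F_PR_iff F)
  then show ?thesis
    by (intro exI[of _ "\<lambda>n. str_code (F (str_decode n))"]) (simp add: F)
qed

lemma F_PR_comp:
  assumes "g \<in> F_PR" and "f \<in> F_PR"
  shows "g \<circ>\<^sub>m f \<in> F_PR"
proof -
  have "partial_rec 1 (\<lambda>xs. Option.bind (map_option str_code (f (str_decode (xs ! 0))))
      (\<lambda>n. map_option str_code (g (str_decode n))))"
    using assms by (intro partial_rec_comp1) (simp_all add: F_PR_iff)
  then have "partial_rec 1 (\<lambda>xs. map_option str_code ((g \<circ>\<^sub>m f) (str_decode (xs ! 0))))"
    by (rule partial_rec_cong) (auto simp: map_comp_def split: option.splits)
  then show ?thesis
    by (simp add: F_PR_iff)
qed

lemma F_REC_comp:
  assumes "g \<in> F_REC" and "f \<in> F_REC"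
  shows "g \<circ>\<^sub>m f \<in> F_REC"
  using assms F_PR_comp[of g f] by (fastforce simp: F_REC_def map_comp_def dom_def split: option.splits)

section \<open>Composing compression functions\<close>

lemma compression_function_comp:
  assumes "compression_function f A B" and "compression_function g B C"
  shows "compression_function (g \<circ>\<^sub>m f) A C"
proof -
  have "(g \<circ>\<^sub>m f) ` A = (\<lambda>x. Option.bind x g) ` f ` A"
    unfolding image_image by (intro image_cong) (auto simp: map_comp_def split: option.splits bind_splits)
  also have "\<dots> = g ` B"
    using assms(1) by (simp add: compression_function_def image_image)
  finally have img: "(g \<circ>\<^sub>m f) ` A = Some ` C"
    using assms(2) by (simp add: compression_function_def)
  \<comment> \<open>Partiality disappears on \<open>A\<close>: there \<open>f\<close> is defined
    with a value in \<open>B\<close>, where \<open>g\<close> is injective.\<close>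
  have eq: "\<exists>b\<in>B. f a = Some b \<and> (g \<circ>\<^sub>m f) a = g b" if "a \<in> A" for a
    using assms(1) that by (force simp: compression_function_def map_comp_def)
  have "inj_on (g \<circ>\<^sub>m f) A"
  proof (rule inj_onI)
    fix a a' assume *: "a \<in> A" "a' \<in> A" "(g \<circ>\<^sub>m f) a = (g \<circ>\<^sub>m f) a'"
    then have "f a = f a'"
      using eq[of a] eq[of a'] assms(2) by (auto simp: compression_function_def inj_on_def)
    with * show "a = a'"
      using assms(1) by (auto simp: compression_function_def inj_on_def)
  qed
  \<comment> \<open>The image of \<open>A\<close> consists of values of \<open>Some\<close>, so no
    element of \<open>A\<close> is mapped to \<open>None\<close>.\<close>
  moreover have "A \<subseteq> dom (g \<circ>\<^sub>m f)"
    using img by (auto simp: dom_def image_iff set_eq_iff)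
  ultimately show ?thesis
    using img by (simp add: compression_function_def)
qed

text \<open>Kept abstract in \<open>F\<close> to serve both equivalences. \<open>g\<close> is
  constrained only on \<open>B\<close>, so elsewhere it may take arbitrary values or
  diverge.\<close>

lemma compressible_iff_UNIV:
  assumes closed: "\<And>f g. g \<in> F \<Longrightarrow> f \<in> F \<Longrightarrow> g \<circ>\<^sub>m f \<in> F"
    and "(\<lambda>w. Some (e w)) \<in> F" and "g \<in> F"
    and ran: "range e = B" and inv: "\<And>w. g (e w) = Some w"
  shows "compressible F A B \<longleftrightarrow> compressible F A UNIV"
proof -
  have "inj e"
    using inv by (metis injI option.inject)
  then have "compression_function (\<lambda>w. Some (e w)) UNIV B"
    using ran by (auto simp: compression_function_def inj_on_def)
  moreover have "compression_function g B UNIV"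
    using inv ran by (auto simp: compression_function_def inj_on_def image_image image_iff)
  ultimately show ?thesis
    using assms(1-3) compression_function_comp unfolding compressible_def by meson
qed

theorem theorem7:
  fixes A B :: "bool list set"
  assumes "infinite A" and "infinite B"
  shows "(recursive B \<longrightarrow> (compressible F_REC A B \<longleftrightarrow> compressible F_REC A UNIV)) \<and>
         (recursively_enumerable B \<longrightarrow> (compressible F_PR A B \<longleftrightarrow> compressible F_PR A UNIV))"
proof (intro conjI impI)
  assume "recursive B"
  then obtain h where h: "total_rec 1 (\<lambda>xs. h (xs ! 0))"
    and "\<And>w. (if w \<in> B then [True] else [False]) = str_decode (h (str_code w))"
    unfolding recursive_def using F_REC_D by fastforce
  then have h_code: "h (str_code w) = str_code (if w \<in> B then [True] else [False])" for w
    by simp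
  define p where "p n = (of_bool (h n \<noteq> str_code [True]) :: nat)" for n
  have p_rec: "total_rec 1 (\<lambda>xs. p (xs ! 0))"
    unfolding p_def by (intro total_rec_neq h total_rec_const)
  have p: "{n. p n = 0} = str_code ` B"
  proof -
    \<comment> \<open>The codes of \<open>[True]\<close> and \<open>[False]\<close> are 2 and 1, so
      comparison with the code of \<open>[True]\<close> decides membership.\<close>
    have "p n = 0 \<longleftrightarrow> str_decode n \<in> B" for n
      using h_code[of "str_decode n"] str_code_snoc[of "[]"] by (simp add: p_def)
    moreover have "str_decode n \<in> B \<longleftrightarrow> n \<in> str_code ` B" for n
      by (metis imageE image_eqI str_code_decode str_decode_code)
    ultimately show ?thesis
      by auto
  qed
  have "inj_on str_code B"
    using bij_str_code by (rule inj_on_subset[OF bij_is_inj subset_UNIV])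
  with assms(2) have inf: "infinite {n. p n = 0}"
    unfolding p by (simp add: finite_image_iff)
  obtain e c where e: "total_rec 1 (\<lambda>xs. e (xs ! 0))"
    and c: "total_rec 1 (\<lambda>xs. c (xs ! 0))"
    and ran: "range e = {n. p n = 0}" and ce: "\<And>k. c (e k) = k"
    using recursive_enumeration[OF p_rec inf] by blast
  have "range (\<lambda>w. str_decode (e (str_code w))) = str_decode ` e ` range str_code"
    by (simp add: image_image)
  also have "\<dots> = B"
    using bij_str_code by (simp add: bij_is_surj ran p image_image)
  finally have "range (\<lambda>w. str_decode (e (str_code w))) = B" .
  \<comment> \<open>Since \<open>c\<close> is total, the inverse also lies in
    \<open>F_REC\<close>.\<close>
  from compressible_iff_UNIV[OF F_REC_comp F_REC_I[OF e] F_REC_I[OF c] this]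
  show "compressible F_REC A B \<longleftrightarrow> compressible F_REC A UNIV"
    by (simp add: ce)
next
  assume "recursively_enumerable B"
  \<comment> \<open>Infinity of \<open>B\<close> rules out the disjunct
    \<open>B = {}\<close>.\<close>
  then obtain f where "f \<in> F_REC" and "ran f = B"
    using assms(2) by (auto simp: recursively_enumerable_def)
  then obtain h where h: "total_rec 1 (\<lambda>xs. h (xs ! 0))"
    and f: "\<And>w. f w = Some (str_decode (h (str_code w)))"
    using F_REC_D by blast
  have "B = range (\<lambda>w. str_decode (h (str_code w)))"
    using \<open>ran f = B\<close> by (auto simp: ran_def f)
  also have "\<dots> = str_decode ` h ` range str_code"
    by (simp add: image_image)
  finally have B: "B = str_decode ` range h"
    using bij_str_code by (simp add: bij_is_surj)
  then have inf: "infinite (range h)"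
    using assms(2) by (metis finite_imageI)
  then obtain e g where e: "total_rec 1 (\<lambda>xs. e (xs ! 0))"
    and g: "partial_rec 1 (\<lambda>xs. g (xs ! 0))"
    and ran: "range e = range h" and ge: "\<And>k. g (e k) = Some k"
    using recursively_enumerable_enumeration[OF h inf] by blast
  have "range (\<lambda>w. str_decode (e (str_code w))) = str_decode ` e ` range str_code"
    by (simp add: image_image)
  also have "\<dots> = B"
    using bij_str_code by (simp add: bij_is_surj ran B)
  finally have "range (\<lambda>w. str_decode (e (str_code w))) = B" .
  \<comment> \<open>The enumeration is total; its inverse may diverge outside \<open>B\<close>, so
    the composition takes place in \<open>F_PR\<close>.\<close>
  moreover have "(\<lambda>w. Some (str_decode (e (str_code w)))) \<in> F_PR"
    using F_REC_I[OF e] by (simp add: F_REC_def)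
  ultimately show "compressible F_PR A B \<longleftrightarrow> compressible F_PR A UNIV"
    using compressible_iff_UNIV[OF F_PR_comp _ F_PR_I[OF g]] by (simp add: ge)
qed

end
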